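(* Let $X_0\in\mathcal{S}$ be a bounded configuration, i.e. $\sup_{k\in\mathbb{Z}}X_0(k)<\infty$. Then for any probability distribution $\mu$ on $\mathbb{N}$, the infinite-bin model $(X_n)_{n\ge 0}$ with reproduction law $\mu$ started from $X_0$ satisfies $X_\infty(k)<\infty$ almost surely, for all $k\in\mathbb{Z}$.
   Context: $\mathbb{N}=\{1,2,\ldots\}$ and $\mathbb{Z}_+=\{0,1,2,\ldots\}$. The set of configurations is $$\mathcal{S}=\Big\{X:\mathbb{Z}\to\mathbb{Z}_+\cup\{\infty\}\ :\ \sup\{j\in\mathbb{Z}: X(j)\neq 0\}\in(-\infty,\infty)\Big\};$$ $X(j)$ is the number of balls in the bin at position $j$ (so a configuration has at least one ball, and bins far enough to the right are empty). For $X\in\mathcal{S}$ and $k\in\mathbb{N}$, let $B(X,k)=\sup\{j\in\mathbb{Z}:\sum_{i=j}^\infty X(i)\ge k\}$ (location of the $k$th rightmost ball), with $\sup\emptyset=-\infty$. For $\xi\in\mathbb{N}$ define $\Phi_\xi:\mathcal{S}\to\mathcal{S}$ by $\Phi_\xi(X)(j)=X(j)+\mathbf{1}_{\{j=B(X,\xi)+1\}}$ for all $j\in\mathbb{Z}$ if $B(X,\xi)>-\infty$, and $\Phi_\xi(X)=X$ otherwise. Given a probability distribution $\mu$ on $\mathbb{N}$ and $X_0\in\mathcal{S}$ (deterministic), the infinite-bin model (IBM) with reproduction law $\mu$ started from $X_0$ is the process defined by $X_{n+1}=\Phi_{\xi_{n+1}}(X_n)$, $n\ge 0$, where $(\xi_n)_{n\ge1}$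 are i.i.d. with law $\mu$. Since $X_n(k)$ is non-decreasing in $n$, the limit $X_\infty(k)=\lim_{n\to\infty}X_n(k)\in\mathbb{Z}_+\cup\{\infty\}$ exists for every $k\in\mathbb{Z}$. *)

theory Defs
  imports "HOL-Probability.Probability"
begin

(* The supremum is taken in ereal, so that "Sup {} = - \<infinity>" as in the usual convention. *)
definition configurations :: "(int \<Rightarrow> enat) set" where
  "configurations =
    {X. - \<infinity> < (SUP j\<in>{j. X j \<noteq> 0}. ereal (of_int j)) \<and>
        (SUP j\<in>{j. X j \<noteq> 0}. ereal (of_int j)) < \<infinity>}"

(* Position of the k-th rightmost ball (k \<ge> 1); it is - \<infinity> if there are fewer than k balls. *)
definition ball_pos :: "(int \<Rightarrow> enat) \<Rightarrow> nat \<Rightarrow> ereal" where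
  "ball_pos X k = (SUP j\<in>{j. enat k \<le> (\<Sum>\<^sub>\<infinity>i\<in>{j..}. X i)}. ereal (of_int j))"

definition ibm_step :: "nat \<Rightarrow> (int \<Rightarrow> enat) \<Rightarrow> int \<Rightarrow> enat" where
  "ibm_step k X =
    (if ball_pos X k > - \<infinity>
     then (\<lambda>j. X j + (if ereal (of_int j) = ball_pos X k + 1 then 1 else 0))
     else X)"

(* The trajectory driven by a sequence x; the entry x 0 is not used. *)
primrec ibm :: "(int \<Rightarrow> enat) \<Rightarrow> (nat \<Rightarrow> nat) \<Rightarrow> nat \<Rightarrow> int \<Rightarrow> enat" where
  "ibm X0 x 0 = X0"
| "ibm X0 x (Suc n) = ibm_step (x (Suc n)) (ibm X0 x n)"

definition ibm_limit :: "(int \<Rightarrow> enat) \<Rightarrow> (nat \<Rightarrow> nat) \<Rightarrow> int \<Rightarrow> enat" where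
  "ibm_limit X0 x k = lim (\<lambda>n. ibm X0 x n k)"

lemma configurations_iff:
  "X \<in> configurations \<longleftrightarrow> (\<exists>j. X j \<noteq> 0) \<and> (\<exists>m. \<forall>j>m. X j = 0)"
proof -
  have "- \<infinity> < (SUP j\<in>{j. X j \<noteq> 0}. ereal (of_int j)) \<longleftrightarrow> (\<exists>j. X j \<noteq> 0)"
    by (auto simp: less_SUP_iff)
  moreover have "(SUP j\<in>{j. X j \<noteq> 0}. ereal (of_int j)) < \<infinity> \<longleftrightarrow> (\<exists>m. \<forall>j>m. X j = 0)"
  proof
    assume "(SUP j\<in>{j. X j \<noteq> 0}. ereal (of_int j)) < \<infinity>"
    then obtain r where r: "(SUP j\<in>{j. X j \<noteq> 0}. ereal (of_int j)) < ereal r"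
      using less_PInf_Ex_of_nat by auto
    have "X j = 0" if "j > \<lceil>r\<rceil>" for j
    proof (rule ccontr)
      assume "X j \<noteq> 0"
      then have "ereal (of_int j) \<le> (SUP j\<in>{j. X j \<noteq> 0}. ereal (of_int j))"
        by (intro SUP_upper) auto
      then have "ereal (of_int j) < ereal r" using r by (rule le_less_trans)
      with that show False by simp linarith
    qed
    then show "\<exists>m. \<forall>j>m. X j = 0" by blast
  next
    assume "\<exists>m. \<forall>j>m. X j = 0"
    then obtain m where "\<forall>j>m. X j = 0" by blast
    then have "(SUP j\<in>{j. X j \<noteq> 0}. ereal (of_int j)) \<le> ereal (of_int m)"
      by (intro SUP_least) (force simp: not_less[symmetric])
    then show "(SUP j\<in>{j. X j \<noteq> 0}. ereal (of_int j)) < \<infinity>"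
      by (rule le_less_trans) simp
  qed
  ultimately show ?thesis by (simp add: configurations_def)
qed

lemma ibm_step_in_configurations:
  assumes "X \<in> configurations"
  shows "ibm_step k X \<in> configurations"
proof -
  obtain j m where jm: "X j \<noteq> 0" "\<forall>i>m. X i = 0"
    using assms by (auto simp: configurations_iff)
  obtain p where p: "\<forall>i>p. ereal (of_int i) \<noteq> ball_pos X k + 1"
  proof (cases "\<exists>i. ereal (of_int i) = ball_pos X k + 1")
    case True
    then obtain i where "ereal (of_int i) = ball_pos X k + 1" by blast
    then show ?thesis by (intro that[of i]) (metis ereal.inject of_int_eq_iff less_irrefl)
  qed (use that in auto)
  have "ibm_step k X j \<noteq> 0" using jm(1) by (simp add: ibm_step_def)
  moreover have "\<forall>i>max m p. ibm_step k X i = 0" using jm(2) p by (simp add: ibm_step_def)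
  ultimately show ?thesis unfolding configurations_iff by blast
qed

lemma ibm_in_configurations: "X0 \<in> configurations \<Longrightarrow> ibm X0 x n \<in> configurations"
  by (induction n) (simp_all add: ibm_step_in_configurations)

lemma incseq_ibm: "incseq (\<lambda>n. ibm X0 x n k)"
  by (rule incseq_SucI) (simp add: ibm_step_def)

lemma ibm_tendsto_limit: "(\<lambda>n. ibm X0 x n k) \<longlonglongrightarrow> ibm_limit X0 x k"
  using LIMSEQ_SUP[OF incseq_ibm] unfolding ibm_limit_def by (metis limI)

(* The tail sums defining ball_pos are unconditionally convergent. *)
lemma configuration_summable: "(X :: int \<Rightarrow> enat) summable_on A"
  by (rule nonneg_summable_on_complete) simp

end

theory Submission
  imports Defs
begin

text \<open>
  The theorem follows from a bound on first moments that is uniform in time: for every \<open>k\<close>,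
  the means \<open>E X\<^sub>n(k)\<close> are bounded in \<open>n\<close>, whence \<open>E X\<^sub>\<infinity>(k) < \<infinity>\<close> by monotone convergence.

  Number the balls from the right, older balls of a bin coming before younger ones. A ball of rank
  \<open>v\<close> has a child, placed in the next bin, exactly at the times when the driving variable equals
  \<open>v\<close>. Then, and more generally whenever the driving variable is at most \<open>v\<close>, some ball appears
  to its right and its rank increases to \<open>v + 1\<close>; a rank never decreases. Hence a ball has at most
  one child while its rank is \<open>v\<close>, and it has one with probability at most
  \<open>h(v) = \<mu>{v} / \<mu>{0..v}\<close>, the conditional probability that the driving variable equals \<open>v\<close>
  given that it is at most \<open>v\<close>. So a ball born with rank at least \<open>r\<close> has at most
  \<open>G(r) = h(r) + h(r + 1) + \<dots>\<close> children on average. This series converges whatever the tail of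
  \<open>\<mu>\<close> is, because \<open>h(v) \<le> \<mu>{v} / \<mu>{m}\<close> for the least \<open>m\<close> charged by \<open>\<mu>\<close>; in
  particular \<open>G(r)\<close> tends to 0. Let \<open>r\<^sub>k\<close> be 1 plus the number of balls of \<open>X\<^sub>0\<close> to the right
  of \<open>k\<close>. Since every ball that ever lies in bin \<open>k\<close> has rank at least \<open>r\<^sub>k\<close>,
  \<open>E X\<^sub>n(k + 1) \<le> X\<^sub>0(k + 1) + G(r\<^sub>k) E X\<^sub>n(k)\<close>,
  which is \<open>mean_load_right_neighbour\<close>. No ball has to be followed individually: the proof
  is a one-step estimate (\<open>potential_step_mean\<close>) for the number of balls in bin \<open>k + 1\<close> plus
  the expected number of children that the balls now in bin \<open>k\<close> can still have.

  The recursion needs a start far to the left. If \<open>X\<^sub>0\<close> has finitely many balls, the bins to their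
  left stay empty. Otherwise \<open>r\<^sub>k\<close> tends to infinity as \<open>k\<close> goes to the left, so
  \<open>G(r\<^sub>k) \<le> 1/2\<close> there: far-left balls reproduce subcritically. At a fixed time \<open>n\<close> the means are
  at most \<open>K + n\<close>, where \<open>K\<close> bounds \<open>X\<^sub>0\<close>, so their supremum \<open>s\<close> over the far-left bins is finite
  and satisfies \<open>s \<le> K + s/2\<close>, that is \<open>s \<le> 2K\<close>, a bound free of \<open>n\<close>
  (\<open>mean_load_bounded_left\<close>). The recursion then carries boundedness to every bin further right.
\<close>

section \<open>One step of the model in terms of ball counts\<close>

definition locally_finite :: "(int \<Rightarrow> enat) \<Rightarrow> bool" where
  "locally_finite X \<longleftrightarrow> (\<forall>j. X j \<noteq> \<infinity>) \<and> (\<exists>m. \<forall>j>m. X j = 0)"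

abbreviation load :: "(int \<Rightarrow> enat) \<Rightarrow> int \<Rightarrow> nat" where
  "load X j \<equiv> the_enat (X j)"

definition balls_from :: "(int \<Rightarrow> enat) \<Rightarrow> int \<Rightarrow> nat" where
  "balls_from X j = the_enat (\<Sum>\<^sub>\<infinity>i\<in>{j..}. X i)"

lemma load_eq: "locally_finite X \<Longrightarrow> enat (load X j) = X j"
  by (cases "X j") (auto simp: locally_finite_def simp del: not_infinity_eq)

lemma infsum_eq_balls_from:
  assumes "locally_finite X"
  shows "(\<Sum>\<^sub>\<infinity>i\<in>{j..}. X i) = enat (balls_from X j)"
proof -
  obtain m where m: "\<forall>j>m. X j = 0" using assms by (auto simp: locally_finite_def)
  have "(\<Sum>\<^sub>\<infinity>i\<in>{j..}. X i) = (\<Sum>\<^sub>\<infinity>i\<in>{j..m}. X i)"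
    by (rule infsum_cong_neutral) (use m in auto)
  also have "\<dots> = (\<Sum>i\<in>{j..m}. enat (load X i))" using load_eq[OF assms] by simp
  also have "\<dots> = enat (\<Sum>i\<in>{j..m}. load X i)"
    by (induction "{j..m}" rule: infinite_finite_induct) (simp_all add: of_nat_eq_enat[symmetric])
  finally show ?thesis by (simp add: balls_from_def)
qed

lemma balls_from_rec:
  assumes "locally_finite X"
  shows "balls_from X j = load X j + balls_from X (j + 1)"
proof -
  have "{j..} = {j} \<union> {j + 1..}" by auto
  then have "(\<Sum>\<^sub>\<infinity>i\<in>{j..}. X i) = (\<Sum>\<^sub>\<infinity>i\<in>{j}. X i) + (\<Sum>\<^sub>\<infinity>i\<in>{j + 1..}. X i)"
    by (simp only:) (intro infsum_Un_disjoint configuration_summable; simp)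
  then have "enat (balls_from X j) = enat (load X j) + enat (balls_from X (j + 1))"
    by (simp add: infsum_eq_balls_from[OF assms] load_eq[OF assms])
  then show ?thesis by simp
qed

lemma antimono_balls_from:
  assumes "locally_finite X"
  shows "antimono (balls_from X)"
proof (rule antimonoI)
  fix i j :: int assume "i \<le> j"
  then show "balls_from X j \<le> balls_from X i"
  proof (induction j rule: int_ge_induct)
    case (step j)
    then show ?case using balls_from_rec[OF assms, of j] by simp
  qed simp
qed

lemma balls_from_eventually_0:
  assumes "locally_finite X"
  obtains m where "\<And>j. j > m \<Longrightarrow> balls_from X j = 0"
proof -
  obtain m where m: "\<forall>j>m. X j = 0" using assms by (auto simp: locally_finite_def)
  have "(\<Sum>\<^sub>\<infinity>i\<in>{j..}. X i) = 0" if "j > m" for j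
    by (rule infsum_0) (use m that in auto)
  then show ?thesis using that[of m] by (simp add: balls_from_def zero_enat_def)
qed

text \<open>The \<open>y\<close>th ball from the right lies in bin \<open>j\<close> iff the count of balls from the right crosses
  \<open>y\<close> there. This replaces the extended-real supremum by counts; bounded support on the right
  guarantees that the supremum is attained.\<close>
lemma ball_pos_eq_iff:
  assumes X: "locally_finite X" and "1 \<le> y"
  shows "ball_pos X y = ereal (of_int j) \<longleftrightarrow> balls_from X (j + 1) < y \<and> y \<le> balls_from X j"
proof -
  let ?S = "{j. y \<le> balls_from X j}"
  have pos: "ball_pos X y = (SUP j\<in>?S. ereal (of_int j))"
    by (simp add: ball_pos_def infsum_eq_balls_from[OF X])
  have *: "ball_pos X y = ereal (of_int i)" if "balls_from X (i + 1) < y" "y \<le> balls_from X i" for i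
  proof -
    have "k \<le> i" if "k \<in> ?S" for k
    proof (rule ccontr)
      assume "\<not> k \<le> i"
      then have "balls_from X k \<le> balls_from X (i + 1)"
        by (intro antimonoD[OF antimono_balls_from[OF X]]) simp
      with that \<open>balls_from X (i + 1) < y\<close> show False by simp
    qed
    then show ?thesis unfolding pos
      by (intro antisym SUP_least SUP_upper) (use that in auto)
  qed
  show ?thesis
  proof
    assume eq: "ball_pos X y = ereal (of_int j)"
    obtain m where m: "\<And>j. j > m \<Longrightarrow> balls_from X j = 0"
      using balls_from_eventually_0[OF X] by blast
    have "?S \<noteq> {}"
    proof
      assume "?S = {}"
      then have "ball_pos X y = - \<infinity>" unfolding pos by (simp add: bot_ereal_def)
      with eq show False by simp
    qed
    then obtain i0 where i0: "y \<le> balls_from X i0" by blast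
    \<comment> \<open>Otherwise the count would stay above \<open>y\<close> all the way to the right.\<close>
    have "\<exists>i. balls_from X (i + 1) < y \<and> y \<le> balls_from X i"
    proof (rule ccontr)
      assume "\<not> ?thesis"
      then have step: "y \<le> balls_from X (i + 1)" if "y \<le> balls_from X i" for i
        using that by force
      have "y \<le> balls_from X i" if "i0 \<le> i" for i
        using that by (induction i rule: int_ge_induct) (use i0 step in auto)
      from this[of "max i0 (m + 1)"] m[of "max i0 (m + 1)"] \<open>1 \<le> y\<close> show False by simp
    qed
    then obtain i where i: "balls_from X (i + 1) < y" "y \<le> balls_from X i" by blast
    with *[OF i] eq show "balls_from X (j + 1) < y \<and> y \<le> balls_from X j" by simp
  qed (use * in blast)
qed

lemma ibm_step_Suc:
  assumes X: "locally_finite X" and "1 \<le> y"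
  shows "ibm_step y X (j + 1) = X (j + 1) +
    (if balls_from X (j + 1) < y \<and> y \<le> balls_from X j then 1 else 0)"
proof -
  have "ereal (of_int (j + 1)) = ball_pos X y + 1 \<longleftrightarrow> ball_pos X y = ereal (of_int j)"
    by (cases "ball_pos X y") (auto simp: one_ereal_def)
  moreover have "ball_pos X y = ereal (of_int j) \<Longrightarrow> ball_pos X y > - \<infinity>" by simp
  ultimately show ?thesis
    unfolding ball_pos_eq_iff[OF assms, symmetric] by (auto simp: ibm_step_def)
qed

text \<open>The index 0 is asked for by no law on the positive integers, but covering it lets pathwise
  statements hold for every driving sequence. All positions count at least 0 balls to their
  right, so the 0th ball sits at \<open>\<infinity>\<close> and no bin receives a ball.\<close>
lemma ibm_step_0 [simp]: "ibm_step 0 X = X"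
proof -
  have "ball_pos X 0 = \<infinity>"
    unfolding ball_pos_def
  proof (rule SUP_PInfty)
    fix n :: nat
    show "\<exists>j\<in>{j. enat 0 \<le> (\<Sum>\<^sub>\<infinity>i\<in>{j..}. X i)}. ereal (real n) \<le> ereal (of_int j)"
      by (rule bexI[of _ "int n"]) (simp_all flip: zero_enat_def)
  qed
  then show ?thesis by (simp add: ibm_step_def)
qed

lemma locally_finite_ibm_step:
  assumes X: "locally_finite X"
  shows "locally_finite (ibm_step y X)"
proof (cases "y = 0")
  case False
  obtain m where m: "\<forall>j>m. X j = 0" using X by (auto simp: locally_finite_def)
  obtain m' where m': "\<And>j. j > m' \<Longrightarrow> balls_from X j = 0"
    using balls_from_eventually_0[OF X] by blast
  have "ibm_step y X j = 0" if "j > max m (m' + 1)" for j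
    using ibm_step_Suc[OF X, of y "j - 1"] m m'[of "j - 1"] that False by simp
  moreover have "ibm_step y X i \<noteq> \<infinity>" for i
    using X by (cases "X i") (auto simp: ibm_step_def locally_finite_def one_enat_def simp del: not_infinity_eq)
  ultimately show ?thesis unfolding locally_finite_def by blast
qed (use X in simp)

lemma load_ibm_step:
  assumes X: "locally_finite X" and "1 \<le> y"
  shows "load (ibm_step y X) (j + 1) = load X (j + 1) +
    (if balls_from X (j + 1) < y \<and> y \<le> balls_from X j then 1 else 0)"
proof -
  obtain c where "X (j + 1) = enat c" using load_eq[OF X, of "j + 1"] by metis
  then show ?thesis by (simp add: ibm_step_Suc[OF assms] one_enat_def zero_enat_def)
qed

text \<open>The new ball lands strictly to the right of \<open>j\<close> iff the ball that it is attached to lies at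
  \<open>j\<close> or further right. The proof starts far to the right, where there are no balls, and adds
  one bin after the other.\<close>
lemma balls_from_ibm_step:
  assumes X: "locally_finite X" and "1 \<le> y"
  shows "balls_from (ibm_step y X) (j + 1) =
    balls_from X (j + 1) + (if y \<le> balls_from X j then 1 else 0)"
proof -
  let ?Y = "ibm_step y X"
  note Y = locally_finite_ibm_step[OF X, of y]
  obtain m where m: "\<And>j. j > m \<Longrightarrow> balls_from X j = 0"
    using balls_from_eventually_0[OF X] by blast
  obtain m' where m': "\<And>j. j > m' \<Longrightarrow> balls_from ?Y j = 0"
    using balls_from_eventually_0[OF Y] by blast
  define b where "b = max j (max m m' + 1)"
  have "j \<le> b" by (simp add: b_def)
  then show ?thesis
  proof (induction j rule: int_le_induct)
    case base
    then show ?case using m[of b] m[of "b + 1"] m'[of "b + 1"] \<open>1 \<le> y\<close> by (simp add: b_def)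
  next
    case (step j)
    have "balls_from X j \<le> balls_from X (j - 1)"
      by (rule antimonoD[OF antimono_balls_from[OF X]]) simp
    then show ?case
      using step.IH balls_from_rec[OF X, of j] balls_from_rec[OF Y, of j]
        load_ibm_step[OF assms, of "j - 1"] by auto
  qed
qed

lemma locally_finite_ibm: "locally_finite X0 \<Longrightarrow> locally_finite (ibm X0 x n)"
  by (induction n) (simp_all add: locally_finite_ibm_step)

lemma balls_from_ibm_mono:
  assumes "locally_finite X0"
  shows "balls_from X0 j \<le> balls_from (ibm X0 x n) j"
proof (induction n)
  case (Suc n)
  have "balls_from (ibm X0 x n) j \<le> balls_from (ibm_step y (ibm X0 x n)) j" for y
    using balls_from_ibm_step[OF locally_finite_ibm[OF assms], of y x n "j - 1"]
    by (cases "y = 0") auto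
  with Suc show ?case by (simp add: order_trans)
qed simp

lemma load_ibm_le:
  assumes "locally_finite X0"
  shows "load (ibm X0 x n) j \<le> load X0 j + n"
proof (induction n)
  case (Suc n)
  have "load (ibm_step y (ibm X0 x n)) j \<le> load (ibm X0 x n) j + 1" for y
    using load_ibm_step[OF locally_finite_ibm[OF assms], of y x n "j - 1"]
    by (cases "y = 0") auto
  from this[of "x (Suc n)"] Suc show ?case by simp
qed simp

text \<open>A bin can only receive a ball if its left neighbour is occupied.\<close>
lemma load_ibm_empty_left:
  assumes X: "locally_finite X0" and "\<And>j. j \<le> k0 \<Longrightarrow> load X0 j = 0" and "j \<le> k0"
  shows "load (ibm X0 x n) j = 0"
  using \<open>j \<le> k0\<close>
proof (induction n arbitrary: j)
  case (Suc n)
  note L = locally_finite_ibm[OF X, of x n]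
  have "load (ibm_step y (ibm X0 x n)) j = 0" for y
    using load_ibm_step[OF L, of y "j - 1"] Suc.IH[of j] Suc.IH[of "j - 1"]
      balls_from_rec[OF L, of "j - 1"] Suc.prems
    by (cases "y = 0") auto
  then show ?case by simp
qed (use assms in simp)

section \<open>The expected number of children of a ball of given rank\<close>

text \<open>The reversed hazard rate of \<open>\<mu>\<close>. Below the support of \<open>\<mu>\<close> it is \<open>0 / 0 = 0\<close>, which is the
  right value since a ball of such a rank has no child.\<close>
definition hazard :: "nat pmf \<Rightarrow> nat \<Rightarrow> real" where
  "hazard \<mu> v = pmf \<mu> v / measure_pmf.prob \<mu> {..v}"

text \<open>The bound for the mean number of children of a ball of rank \<open>r\<close>.\<close>
definition hazard_tail :: "nat pmf \<Rightarrow> nat \<Rightarrow> real" where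
  "hazard_tail \<mu> r = (\<Sum>n. hazard \<mu> (n + r))"

lemma hazard_nonneg: "0 \<le> hazard \<mu> v"
  by (simp add: hazard_def)

text \<open>The balance behind the estimate: a ball of rank \<open>v\<close> in a bin whose last ball has rank \<open>w\<close>
  has a child with probability \<open>\<mu>{v}\<close>, and with probability \<open>\<mu>{..w}\<close> its rank moves on,
  which uses up the contribution \<open>hazard \<mu> v\<close> of the current rank.\<close>
lemma pmf_le_hazard_mult:
  assumes "v \<le> w"
  shows "pmf \<mu> v \<le> hazard \<mu> v * measure_pmf.prob \<mu> {..w}"
proof -
  have "pmf \<mu> v \<le> measure_pmf.prob \<mu> {..v}"
    unfolding measure_pmf_single[symmetric] by (rule measure_pmf.finite_measure_mono) auto
  then have "pmf \<mu> v = hazard \<mu> v * measure_pmf.prob \<mu> {..v}"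
    using pmf_nonneg[of \<mu> v] by (auto simp: hazard_def)
  also have "\<dots> \<le> hazard \<mu> v * measure_pmf.prob \<mu> {..w}"
    using assms by (intro mult_left_mono measure_pmf.finite_measure_mono hazard_nonneg) auto
  finally show ?thesis .
qed

text \<open>No moment of \<open>\<mu>\<close> is involved: from the least point \<open>m\<close> of the support onwards, the denominators
  are at least \<open>pmf \<mu> m\<close>, so the hazards are dominated by a multiple of the point masses.\<close>
lemma summable_hazard: "summable (hazard \<mu>)"
proof -
  define m where "m = (LEAST v. v \<in> set_pmf \<mu>)"
  have m: "m \<in> set_pmf \<mu>" unfolding m_def using set_pmf_not_empty[of \<mu>] by (metis LeastI ex_in_conv)
  have pos: "pmf \<mu> m > 0" using m by (rule pmf_positive)
  have le: "hazard \<mu> v \<le> pmf \<mu> v / pmf \<mu> m" for v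
  proof (cases "v \<in> set_pmf \<mu>")
    case True
    then have "m \<le> v" unfolding m_def by (rule Least_le)
    then have "pmf \<mu> m \<le> measure_pmf.prob \<mu> {..v}"
      unfolding measure_pmf_single[symmetric] by (intro measure_pmf.finite_measure_mono) auto
    then show ?thesis unfolding hazard_def using pos by (intro divide_left_mono) auto
  qed (simp add: hazard_def set_pmf_iff)
  have "summable (pmf \<mu>)"
    by (rule summableI_nonneg_bounded[where x = 1])
      (simp_all add: measure_measure_pmf_finite[symmetric])
  then have "summable (\<lambda>v. pmf \<mu> v / pmf \<mu> m)" by (rule summable_divide)
  then show ?thesis
    by (rule summable_comparison_test') (use le hazard_nonneg in auto)
qed

lemma hazard_tail_rec: "hazard_tail \<mu> r = hazard \<mu> r + hazard_tail \<mu> (r + 1)"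
proof -
  have "summable (\<lambda>n. hazard \<mu> (n + r))"
    using summable_hazard by (rule summable_ignore_initial_segment)
  from suminf_split_head[OF this] show ?thesis by (simp add: hazard_tail_def)
qed

lemma hazard_tail_nonneg: "0 \<le> hazard_tail \<mu> r"
  unfolding hazard_tail_def
  by (intro suminf_nonneg summable_ignore_initial_segment summable_hazard hazard_nonneg)

lemma hazard_tail_antimono: "r \<le> s \<Longrightarrow> hazard_tail \<mu> s \<le> hazard_tail \<mu> r"
  by (rule lift_Suc_antimono_le[where f = "hazard_tail \<mu>"])
    (subst (2) hazard_tail_rec, simp_all add: hazard_nonneg)

lemma hazard_tail_tendsto_0: "hazard_tail \<mu> \<longlonglongrightarrow> 0"
  unfolding hazard_tail_def[abs_def] by (rule suminf_exist_split2[OF summable_hazard])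

text \<open>The bound for the mean number of children that \<open>a\<close> balls, of ranks \<open>N + 1\<close> to \<open>N + a\<close>, can
  still have.\<close>
definition potential :: "nat pmf \<Rightarrow> nat \<Rightarrow> nat \<Rightarrow> real" where
  "potential \<mu> N a = (\<Sum>i=1..a. hazard_tail \<mu> (N + i))"

lemma potential_nonneg: "0 \<le> potential \<mu> N a"
  unfolding potential_def by (intro sum_nonneg hazard_tail_nonneg)

lemma potential_le: "potential \<mu> N a \<le> hazard_tail \<mu> (N + 1) * a"
proof -
  have "potential \<mu> N a \<le> (\<Sum>i=1..a. hazard_tail \<mu> (N + 1))"
    unfolding potential_def by (intro sum_mono hazard_tail_antimono) auto
  then show ?thesis by (simp add: mult.commute)
qed

lemma potential_shift: "potential \<mu> (N + 1) a + (\<Sum>i=1..a. hazard \<mu> (N + i)) = potential \<mu> N a"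
  unfolding potential_def sum.distrib[symmetric]
  by (intro sum.cong refl) (subst (2) hazard_tail_rec, simp)

section \<open>The one-step estimate\<close>

text \<open>Let bin \<open>k\<close> hold \<open>a\<close> balls and let \<open>N\<close> balls lie to its right. An index \<open>y \<le> N + a\<close> shifts
  all ranks in bin \<open>k\<close>, so the potential loses the current hazards, and bin \<open>k + 1\<close> gains a ball if
  moreover \<open>N < y\<close>. On average the loss is at least the gain. The only other change is a new
  ball in bin \<open>k\<close>, which adds at most \<open>hazard_tail \<mu> r\<close> to the potential. The terms with
  \<open>hazard_tail \<mu> r\<close> stand on both sides so that no subtraction of possibly infinite
  integrals occurs.\<close>
lemma potential_step_mean:
  assumes X: "locally_finite X" and \<mu>: "set_pmf \<mu> \<subseteq> {1..}"
    and r: "r \<le> balls_from X (k + 1) + 1"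
  defines "\<phi> \<equiv> \<lambda>X. load X (k + 1) + potential \<mu> (balls_from X (k + 1)) (load X k)"
  shows "(\<integral>\<^sup>+y. \<phi> (ibm_step y X) \<partial>measure_pmf \<mu>) + hazard_tail \<mu> r * load X k
    \<le> \<phi> X + (\<integral>\<^sup>+y. hazard_tail \<mu> r * load (ibm_step y X) k \<partial>measure_pmf \<mu>)"
proof -
  define N a c where local_defs: "N = balls_from X (k + 1)" "a = load X k" "c = hazard_tail \<mu> r"
  define S where "S = (\<Sum>i=1..a. hazard \<mu> (N + i))"
  have S0: "0 \<le> S" unfolding S_def by (intro sum_nonneg hazard_nonneg)
  have c0: "0 \<le> c" by (simp add: local_defs hazard_tail_nonneg)
  have \<phi>0: "0 \<le> \<phi> Y" for Y by (simp add: \<phi>_def potential_nonneg)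
  have Nk: "balls_from X k = N + a" using balls_from_rec[OF X, of k] by (simp add: local_defs)
  \<comment> \<open>\<open>S\<close> is the loss of potential; it is moved to the left to keep all terms nonnegative.\<close>
  have pw: "\<phi> (ibm_step y X) + S * indicator {..N + a} y + c * a
      \<le> \<phi> X + c * load (ibm_step y X) k + indicator {N<..N + a} y" if "1 \<le> y" for y
  proof -
    note 1 = load_ibm_step[OF X that, of k] load_ibm_step[OF X that, of "k - 1"]
      balls_from_ibm_step[OF X that, of k]
    have 2: "N + a \<le> balls_from X (k - 1)"
      using antimonoD[OF antimono_balls_from[OF X], of "k - 1" k] Nk by simp
    show ?thesis
    proof (cases "y \<le> N + a")
      case True
      then show ?thesis using 1 2 Nk potential_shift[of \<mu> N a]
        by (auto simp: \<phi>_def local_defs S_def indicator_def)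
    next
      case False
      have "hazard_tail \<mu> (N + Suc a) \<le> c"
        unfolding local_defs(3) by (rule hazard_tail_antimono) (use r in \<open>simp add: local_defs\<close>)
      then have "potential \<mu> N (Suc a) \<le> potential \<mu> N a + c" by (simp add: potential_def)
      then show ?thesis using 1 2 Nk False
        by (auto simp: \<phi>_def local_defs indicator_def algebra_simps)
    qed
  qed
  let ?A = "\<integral>\<^sup>+y. \<phi> (ibm_step y X) \<partial>measure_pmf \<mu>" and ?B = "\<integral>\<^sup>+y. c * load (ibm_step y X) k \<partial>measure_pmf \<mu>"
  let ?F = "measure_pmf.prob \<mu> {..N + a}" and ?I = "measure_pmf.prob \<mu> {N<..N + a}"
  have "?A + ennreal (S * ?F) + ennreal (c * a)
      = (\<integral>\<^sup>+y. ennreal (\<phi> (ibm_step y X)) + ennreal S * indicator {..N + a} y + ennreal (c * a) \<partial>measure_pmf \<mu>)"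
    using S0 by (simp add: nn_integral_add nn_integral_cmult measure_pmf.emeasure_eq_measure
        ennreal_mult measure_pmf.emeasure_space_1[simplified])
  also have "\<dots> = (\<integral>\<^sup>+y. ennreal (\<phi> (ibm_step y X) + S * indicator {..N + a} y + c * a) \<partial>measure_pmf \<mu>)"
    using S0 c0 \<phi>0 by (intro nn_integral_cong) (auto simp: indicator_def simp flip: ennreal_plus)
  also have "\<dots> \<le> (\<integral>\<^sup>+y. ennreal (\<phi> X + c * load (ibm_step y X) k + indicator {N<..N + a} y) \<partial>measure_pmf \<mu>)"
    using pw \<mu> by (intro nn_integral_mono_AE) (auto simp: AE_measure_pmf_iff intro!: ennreal_leI)
  also have "\<dots> = (\<integral>\<^sup>+y. ennreal (\<phi> X) + ennreal (c * load (ibm_step y X) k) + indicator {N<..N + a} y \<partial>measure_pmf \<mu>)"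
    using S0 c0 \<phi>0 by (intro nn_integral_cong) (auto simp: indicator_def simp flip: ennreal_plus ennreal_1)
  also have "\<dots> = \<phi> X + ?B + ennreal ?I"
    by (simp add: nn_integral_add measure_pmf.emeasure_eq_measure measure_pmf.emeasure_space_1[simplified])
  also have "ennreal ?I \<le> ennreal (S * ?F)"
  proof (rule ennreal_leI)
    have "bij_betw (\<lambda>i. N + i) {1..a} {N<..N + a}"
      by (rule bij_betw_byWitness[where f' = "\<lambda>v. v - N"]) auto
    then have "?I = (\<Sum>i=1..a. pmf \<mu> (N + i))"
      by (simp add: measure_measure_pmf_finite sum.reindex_bij_betw)
    also have "\<dots> \<le> (\<Sum>i=1..a. hazard \<mu> (N + i) * ?F)"
      by (intro sum_mono pmf_le_hazard_mult) auto
    finally show "?I \<le> S * ?F" by (simp add: S_def sum_distrib_right)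
  qed
  finally have "ennreal (S * ?F) + (?A + ennreal (c * a)) \<le> ennreal (S * ?F) + (\<phi> X + ?B)"
    by (simp add: ac_simps add_mono)
  then show ?thesis by (simp add: local_defs ennreal_add_left_cancel_le)
qed

section \<open>The process driven by independent variables\<close>

lemma ibm_cong:
  assumes "\<And>i. i \<in> {1..n} \<Longrightarrow> x i = x' i"
  shows "ibm X0 x n = ibm X0 x' n"
  using assms by (induction n) simp_all

locale iid_driven = prob_space M for M :: "'a measure" +
  fixes \<mu> :: "nat pmf" and \<xi> :: "nat \<Rightarrow> 'a \<Rightarrow> nat"
  assumes law_pos: "set_pmf \<mu> \<subseteq> {1..}"
    and indep: "indep_vars (\<lambda>_. count_space UNIV) \<xi> {1..}"
    and distr: "\<And>n. n \<ge> 1 \<Longrightarrow> distr M (count_space UNIV) (\<xi> n) = measure_pmf \<mu>"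
begin

abbreviation state :: "(int \<Rightarrow> enat) \<Rightarrow> nat \<Rightarrow> 'a \<Rightarrow> int \<Rightarrow> enat" where
  "state X0 n \<omega> \<equiv> ibm X0 (\<lambda>i. \<xi> i \<omega>) n"

lemma measurable_driver: "\<xi> (Suc n) \<in> measurable M (count_space UNIV)"
  by (rule conjunct1[OF indep[unfolded indep_vars_def2], THEN bspec]) simp

lemma measurable_state: "state X0 n \<in> measurable M (count_space UNIV)"
proof (induction n)
  case (Suc n)
  from measurable_driver have "(\<lambda>\<omega>. ibm_step (\<xi> (Suc n) \<omega>) (state X0 n \<omega>)) \<in> measurable M (count_space UNIV)"
    by (rule measurable_compose_countable'[rotated])
      (auto intro!: measurable_compose[OF Suc])
  then show ?case by simp
qed simp

lemma measurable_fun_state [measurable]: "(\<lambda>\<omega>. f (state X0 n \<omega>)) \<in> measurable M borel"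
  by (rule measurable_compose[OF measurable_state]) simp

text \<open>The Markov property. The state at time \<open>n\<close> depends on \<open>\<xi>\<^sub>1, \<dots>, \<xi>\<^sub>n\<close> only, so it is independent of
  \<open>\<xi>\<^sub>n\<^sub>+\<^sub>1\<close>. The space of configurations is uncountable, so the product measure is taken on
  the space of driving sequences of length \<open>n\<close> instead: it is countable, and every function on it
  is measurable.\<close>
lemma nn_integral_state_Suc:
  fixes f :: "(int \<Rightarrow> enat) \<Rightarrow> ennreal"
  shows "(\<integral>\<^sup>+\<omega>. f (state X0 (Suc n) \<omega>) \<partial>M) =
    (\<integral>\<^sup>+\<omega>. (\<integral>\<^sup>+y. f (ibm_step y (state X0 n \<omega>)) \<partial>measure_pmf \<mu>) \<partial>M)"
proof -
  define P where "P A = PiM A (\<lambda>_. count_space (UNIV :: nat set))" for A :: "nat set"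
  define Y where "Y \<omega> = restrict (\<lambda>i. \<xi> i \<omega>) {1..n}" for \<omega>
  have P: "P A = count_space (PiE A (\<lambda>_. UNIV))" if "finite A" for A
    unfolding P_def by (intro count_space_PiM_finite that) auto
  have cnt: "countable (PiE A (\<lambda>_. UNIV :: nat set))" if "finite A" for A :: "nat set"
    by (intro countable_PiE that) auto
  \<comment> \<open>\<open>\<xi> (Suc n)\<close> as a function on a singleton, since both members of an independent pair must
    have values in the same type.\<close>
  define Z where "Z \<omega> = restrict (\<lambda>i. \<xi> i \<omega>) {Suc n}" for \<omega>
  have ind: "indep_var (P {1..n}) Y (P {Suc n}) Z"
    unfolding P_def Y_def Z_def by (rule indep_var_restrict[OF indep]) auto
  have rv: "Y \<in> measurable M (P {1..n})" "Z \<in> measurable M (P {Suc n})"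
    using ind by (auto dest: indep_var_rv1 indep_var_rv2)
  have P': "P {1..n} \<Otimes>\<^sub>M P {Suc n} =
      count_space (PiE {1..n} (\<lambda>_. UNIV) \<times> PiE {Suc n} (\<lambda>_. UNIV :: nat set))"
    by (simp add: P pair_measure_countable cnt)
  let ?h = "\<lambda>(x, z). f (ibm_step (z (Suc n)) (ibm X0 x n))"
  have hm: "?h \<in> borel_measurable (P {1..n} \<Otimes>\<^sub>M P {Suc n})"
    unfolding P' by simp
  have ibmY: "ibm X0 (Y \<omega>) n = ibm X0 (\<lambda>i. \<xi> i \<omega>) n" for \<omega>
    by (rule ibm_cong) (simp add: Y_def)
  have inner: "(\<integral>\<^sup>+z. ?h (x, z) \<partial>distr M (P {Suc n}) Z) =
      (\<integral>\<^sup>+y. f (ibm_step y (ibm X0 x n)) \<partial>measure_pmf \<mu>)" for x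
  proof -
    have "(\<integral>\<^sup>+z. ?h (x, z) \<partial>distr M (P {Suc n}) Z) = (\<integral>\<^sup>+\<omega>. ?h (x, Z \<omega>) \<partial>M)"
      by (rule nn_integral_distr) (use rv in \<open>auto simp: P\<close>)
    also have "\<dots> = (\<integral>\<^sup>+\<omega>. f (ibm_step (\<xi> (Suc n) \<omega>) (ibm X0 x n)) \<partial>M)"
      by (simp add: Z_def)
    also have "\<dots> = (\<integral>\<^sup>+y. f (ibm_step y (ibm X0 x n)) \<partial>distr M (count_space UNIV) (\<xi> (Suc n)))"
      by (rule nn_integral_distr[symmetric]) (use measurable_driver in auto)
    finally show ?thesis by (simp add: distr)
  qed
  interpret Z: prob_space "distr M (P {Suc n}) Z" by (rule prob_space_distr) (rule rv)
  have "(\<integral>\<^sup>+\<omega>. f (ibm X0 (\<lambda>i. \<xi> i \<omega>) (Suc n)) \<partial>M) = (\<integral>\<^sup>+\<omega>. ?h (Y \<omega>, Z \<omega>) \<partial>M)"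
    by (simp add: ibmY Z_def)
  also have "\<dots> = (\<integral>\<^sup>+p. ?h p \<partial>distr M (P {1..n} \<Otimes>\<^sub>M P {Suc n}) (\<lambda>\<omega>. (Y \<omega>, Z \<omega>)))"
    by (rule nn_integral_distr[symmetric]) (use rv hm in \<open>auto intro!: measurable_Pair\<close>)
  also have "\<dots> = (\<integral>\<^sup>+p. ?h p \<partial>(distr M (P {1..n}) Y \<Otimes>\<^sub>M distr M (P {Suc n}) Z))"
    using ind unfolding indep_var_distribution_eq by simp
  also have "\<dots> = (\<integral>\<^sup>+x. (\<integral>\<^sup>+z. ?h (x, z) \<partial>distr M (P {Suc n}) Z) \<partial>distr M (P {1..n}) Y)"
  proof (rule Z.nn_integral_fst[symmetric])
    have "sets (distr M (P {1..n}) Y \<Otimes>\<^sub>M distr M (P {Suc n}) Z) = sets (P {1..n} \<Otimes>\<^sub>M P {Suc n})"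
      by (intro sets_pair_measure_cong) auto
    then show "?h \<in> borel_measurable (distr M (P {1..n}) Y \<Otimes>\<^sub>M distr M (P {Suc n}) Z)"
      using hm by (simp cong: measurable_cong_sets)
  qed
  also have "\<dots> = (\<integral>\<^sup>+x. (\<integral>\<^sup>+y. f (ibm_step y (ibm X0 x n)) \<partial>measure_pmf \<mu>) \<partial>distr M (P {1..n}) Y)"
    by (simp only: inner)
  also have "\<dots> = (\<integral>\<^sup>+\<omega>. (\<integral>\<^sup>+y. f (ibm_step y (ibm X0 (Y \<omega>) n)) \<partial>measure_pmf \<mu>) \<partial>M)"
    by (rule nn_integral_distr) (use rv in \<open>auto simp: P\<close>)
  finally show ?thesis by (simp add: ibmY)
qed

definition mean_load :: "(int \<Rightarrow> enat) \<Rightarrow> nat \<Rightarrow> int \<Rightarrow> ennreal" where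
  "mean_load X0 n k = (\<integral>\<^sup>+\<omega>. ennreal (load (state X0 n \<omega>) k) \<partial>M)"

text \<open>A bound that grows with time, used only to know that the means are finite.\<close>
lemma mean_load_le:
  assumes "locally_finite X0" and "load X0 k \<le> K"
  shows "mean_load X0 n k \<le> ennreal (real (K + n))"
proof -
  have "mean_load X0 n k \<le> (\<integral>\<^sup>+\<omega>. ennreal (real (K + n)) \<partial>M)"
    unfolding mean_load_def
    using load_ibm_le[OF assms(1), of _ n k] assms(2) 
    by (intro nn_integral_mono ennreal_leI) (metis (mono_tags) add_le_mono1 le_trans of_nat_le_iff)
  then show ?thesis by (simp add: emeasure_space_1)
qed

text \<open>Every ball that bin \<open>k\<close> ever holds has at most \<open>c\<close> children in bin \<open>k + 1\<close> on average. When the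
  one-step estimate is summed over time, the initial potential, at most \<open>c * load X0 k\<close>, pays for
  the children of the balls present at the start, and \<open>c\<close> times the mean growth of bin \<open>k\<close> for
  those of the later balls; together this is \<open>c * mean_load X0 n k\<close>.\<close>
lemma mean_load_right_neighbour:
  fixes k :: int
  assumes X0: "locally_finite X0"
  defines "c \<equiv> hazard_tail \<mu> (balls_from X0 (k + 1) + 1)"
  shows "mean_load X0 n (k + 1) \<le> ennreal (load X0 (k + 1)) + c * mean_load X0 n k"
proof -
  define \<phi> :: "(int \<Rightarrow> enat) \<Rightarrow> real"
    where "\<phi> X = load X (k + 1) + potential \<mu> (balls_from X (k + 1)) (load X k)" for X
  define \<Phi> where "\<Phi> n = (\<integral>\<^sup>+\<omega>. \<phi> (state X0 n \<omega>) \<partial>M)" for n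
  have c0: "0 \<le> c" by (simp add: c_def hazard_tail_nonneg)
  have \<Lambda>: "(\<integral>\<^sup>+\<omega>. c * load (state X0 n \<omega>) k \<partial>M) = c * mean_load X0 n k" for n
    unfolding mean_load_def using c0
    by (simp add: ennreal_mult nn_integral_cmult)
  have step: "\<Phi> (Suc n) + c * mean_load X0 n k \<le> \<Phi> n + c * mean_load X0 (Suc n) k" for n
  proof -
    have "\<Phi> (Suc n) + c * mean_load X0 n k =
        (\<integral>\<^sup>+\<omega>. (\<integral>\<^sup>+y. \<phi> (ibm_step y (state X0 n \<omega>)) \<partial>measure_pmf \<mu>) + c * load (state X0 n \<omega>) k \<partial>M)"
      unfolding \<Phi>_def nn_integral_state_Suc[of "\<lambda>X. ennreal (\<phi> X)"] \<Lambda>[symmetric]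
      by (rule nn_integral_add[symmetric]) measurable
    also have "\<dots> \<le> (\<integral>\<^sup>+\<omega>. \<phi> (state X0 n \<omega>) + (\<integral>\<^sup>+y. c * load (ibm_step y (state X0 n \<omega>)) k \<partial>measure_pmf \<mu>) \<partial>M)"
    proof (rule nn_integral_mono)
      fix \<omega>
      show "(\<integral>\<^sup>+y. \<phi> (ibm_step y (state X0 n \<omega>)) \<partial>measure_pmf \<mu>) + c * load (state X0 n \<omega>) k
        \<le> \<phi> (state X0 n \<omega>) + (\<integral>\<^sup>+y. c * load (ibm_step y (state X0 n \<omega>)) k \<partial>measure_pmf \<mu>)"
        unfolding \<phi>_def c_def
        by (rule potential_step_mean[OF locally_finite_ibm[OF X0] law_pos])
          (simp add: balls_from_ibm_mono[OF X0])
    qed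
    also have "\<dots> = \<Phi> n + c * mean_load X0 (Suc n) k"
      unfolding \<Phi>_def \<Lambda>[symmetric] nn_integral_state_Suc[of "\<lambda>X. ennreal (c * load X k)"]
      by (rule nn_integral_add) measurable
    finally show ?thesis .
  qed
  have fin: "ennreal c * mean_load X0 n k < top" for n
    using mean_load_le[OF X0 order_refl, of n k]
    by (intro ennreal_mult_less_top[THEN iffD2]) (auto simp: le_less_trans)
  have total: "\<Phi> n + c * load X0 k \<le> \<phi> X0 + c * mean_load X0 n k" for n
  proof (induction n)
    case 0
    then show ?case using c0 by (simp add: \<Phi>_def mean_load_def emeasure_space_1 ennreal_mult)
  next
    case (Suc n)
    have "c * mean_load X0 n k + (\<Phi> (Suc n) + c * load X0 k)
        \<le> \<Phi> n + c * mean_load X0 (Suc n) k + c * load X0 k"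
      using add_right_mono[OF step[of n], of "ennreal (c * load X0 k)"] by (simp only: ac_simps)
    also have "\<dots> \<le> c * mean_load X0 n k + (\<phi> X0 + c * mean_load X0 (Suc n) k)"
      using add_right_mono[OF Suc, of "ennreal c * mean_load X0 (Suc n) k"] by (simp only: ac_simps)
    finally show ?case using fin[of n] by (auto simp: ennreal_add_left_cancel_le)
  qed
  have "mean_load X0 n (k + 1) \<le> \<Phi> n"
    unfolding mean_load_def \<Phi>_def \<phi>_def
    by (intro nn_integral_mono ennreal_leI) (simp add: potential_nonneg)
  then have "ennreal (c * load X0 k) + mean_load X0 n (k + 1) \<le> \<Phi> n + c * load X0 k"
    by (subst add.commute) (rule add_right_mono)
  also note total[of n]
  also have "ennreal (\<phi> X0) \<le> ennreal (c * load X0 k) + ennreal (load X0 (k + 1))"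
    using potential_le[of \<mu> "balls_from X0 (k + 1)" "load X0 k"] c0
    by (simp add: \<phi>_def c_def ennreal_leI flip: ennreal_plus)
  finally show ?thesis by (simp add: add.assoc ennreal_add_left_cancel_le)
qed

text \<open>Either the far-left bins are empty for ever, or the balls there have such large ranks that
  they have at most 1/2 child on average; then the means at time \<open>n\<close> satisfy a contracting
  recursion, whose solution forgets the bound \<open>K + n\<close> at \<open>- \<infinity>\<close>.\<close>
lemma mean_load_bounded_left:
  assumes X0: "locally_finite X0" and K: "\<And>k. load X0 k \<le> K"
  shows "\<exists>k0. \<forall>k\<le>k0. \<forall>n. mean_load X0 n k \<le> ennreal (2 * real K)"
proof (cases "\<exists>k0. \<forall>j\<le>k0. load X0 j = 0")
  case True
  then obtain k0 where "\<And>j. j \<le> k0 \<Longrightarrow> load X0 j = 0" by blast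
  from load_ibm_empty_left[OF X0 this] show ?thesis
    by (intro exI[of _ k0]) (simp add: mean_load_def)
next
  case False
  have unbounded: "\<exists>j. r \<le> balls_from X0 j" for r
  proof (induction r)
    case (Suc r)
    then obtain j where j: "r \<le> balls_from X0 j" by blast
    obtain i where i: "i \<le> j - 1" "load X0 i \<noteq> 0" using False by blast
    have "balls_from X0 j \<le> balls_from X0 (i + 1)"
      by (rule antimonoD[OF antimono_balls_from[OF X0]]) (use i in simp)
    then show ?case using i j balls_from_rec[OF X0, of i] by (intro exI[of _ i]) simp
  qed simp
  have "eventually (\<lambda>r. hazard_tail \<mu> r < 1 / 2) sequentially"
    using hazard_tail_tendsto_0 by (rule order_tendstoD) simp
  then obtain r where r: "hazard_tail \<mu> r < 1 / 2" by (auto simp: eventually_sequentially)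
  obtain k0 where k0: "r \<le> balls_from X0 k0" using unbounded by blast
  have half: "mean_load X0 n k \<le> ennreal K + ennreal (1 / 2) * mean_load X0 n (k - 1)" if "k \<le> k0" for n k
  proof -
    have "balls_from X0 k0 \<le> balls_from X0 k"
      by (rule antimonoD[OF antimono_balls_from[OF X0] that])
    then have "hazard_tail \<mu> (balls_from X0 k + 1) \<le> hazard_tail \<mu> r"
      using k0 by (intro hazard_tail_antimono) simp
    then have "hazard_tail \<mu> (balls_from X0 k + 1) \<le> 1 / 2" using r by simp
    then have "ennreal (load X0 k) + hazard_tail \<mu> (balls_from X0 k + 1) * mean_load X0 n (k - 1)
        \<le> ennreal K + ennreal (1 / 2) * mean_load X0 n (k - 1)"
      using K[of k] by (intro add_mono mult_right_mono ennreal_leI) simp_all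
    with mean_load_right_neighbour[OF X0, of n "k - 1"] show ?thesis by simp
  qed
  have "mean_load X0 n k \<le> ennreal (2 * real K)" if "k \<le> k0" for n k
  proof -
    \<comment> \<open>Finiteness of \<open>s\<close> is what makes \<open>s \<le> K + s / 2\<close> informative.\<close>
    define s where "s = (SUP k\<in>{..k0}. mean_load X0 n k)"
    have "s \<le> ennreal (real (K + n))"
      unfolding s_def by (intro SUP_least mean_load_le[OF X0 K])
    then have "s < top" by (rule le_less_trans) simp
    then obtain t where t: "s = ennreal t" "0 \<le> t" by (cases s) auto
    have "s \<le> ennreal K + ennreal (1 / 2) * s"
      unfolding s_def
    proof (rule SUP_least)
      fix k assume k: "k \<in> {..k0}"
      then have "mean_load X0 n (k - 1) \<le> (SUP k\<in>{..k0}. mean_load X0 n k)"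
        by (intro SUP_upper) simp
      then have "ennreal K + ennreal (1 / 2) * mean_load X0 n (k - 1)
          \<le> ennreal K + ennreal (1 / 2) * (SUP k\<in>{..k0}. mean_load X0 n k)"
        by (intro add_left_mono mult_left_mono) auto
      with half[of k n] k show "mean_load X0 n k \<le> ennreal K + ennreal (1 / 2) * (SUP k\<in>{..k0}. mean_load X0 n k)"
        by (auto intro: order_trans)
    qed
    also have "ennreal (1 / 2) * s = ennreal (t / 2)"
      unfolding t(1) using t(2) by (subst ennreal_mult[symmetric]) auto
    also have "ennreal K + ennreal (t / 2) = ennreal (K + t / 2)"
      using t(2) by (intro ennreal_plus[symmetric]) auto
    finally have "t \<le> K + t / 2" using t by (simp add: ennreal_le_iff del: ennreal_plus)
    then have "t \<le> 2 * real K" by simp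
    then have "s \<le> ennreal (2 * real K)" using t by (simp add: ennreal_leI)
    moreover have "mean_load X0 n k \<le> s" unfolding s_def using that by (intro SUP_upper) simp
    ultimately show ?thesis by (rule order_trans[rotated])
  qed
  then show ?thesis by blast
qed

lemma mean_load_bounded:
  assumes X0: "locally_finite X0" and K: "\<And>k. load X0 k \<le> K"
  shows "\<exists>C. \<forall>n. mean_load X0 n k \<le> ennreal C"
proof -
  obtain k0 where k0: "\<And>k n. k \<le> k0 \<Longrightarrow> mean_load X0 n k \<le> ennreal (2 * real K)"
    using mean_load_bounded_left[OF X0 K] by blast
  show ?thesis
  proof (cases "k \<le> k0")
    case False
    then have "k0 \<le> k" by simp
    then show ?thesis
    proof (induction k rule: int_ge_induct)
      case base
      then show ?case using k0 by blast
    next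
      case (step k)
      then obtain C where C: "\<And>n. mean_load X0 n k \<le> ennreal C" by blast
      define c where "c = hazard_tail \<mu> (balls_from X0 (k + 1) + 1)"
      have "mean_load X0 n (k + 1) \<le> ennreal (load X0 (k + 1) + c * max 0 C)" for n
      proof -
        have "mean_load X0 n (k + 1) \<le> ennreal (load X0 (k + 1)) + c * mean_load X0 n k"
          unfolding c_def by (rule mean_load_right_neighbour[OF X0])
        also have "\<dots> \<le> ennreal (load X0 (k + 1)) + c * ennreal (max 0 C)"
          using C[of n] by (intro add_left_mono mult_left_mono) (auto simp: max_def ennreal_neg)
        also have "\<dots> = ennreal (load X0 (k + 1) + c * max 0 C)"
          by (simp add: c_def hazard_tail_nonneg ennreal_mult)
        finally show ?thesis .
      qed
      then show ?case by blast
    qed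
  qed (use k0 in blast)
qed

lemma AE_ibm_limit_finite:
  assumes X0: "locally_finite X0" and K: "\<And>k. load X0 k \<le> K"
  shows "AE \<omega> in M. ibm_limit X0 (\<lambda>i. \<xi> i \<omega>) k < \<infinity>"
proof -
  obtain C where C: "\<And>n. mean_load X0 n k \<le> ennreal C" using mean_load_bounded[OF X0 K] by blast
  have load: "ennreal_of_enat (state X0 n \<omega> k) = ennreal (load (state X0 n \<omega>) k)" for n \<omega>
    by (subst load_eq[OF locally_finite_ibm[OF X0], symmetric])
      (simp add: ennreal_of_nat_eq_real_of_nat)
  have lim: "ennreal_of_enat (ibm_limit X0 (\<lambda>i. \<xi> i \<omega>) k) = (SUP n. ennreal (load (state X0 n \<omega>) k))" for \<omega>
  proof -
    have "ibm_limit X0 (\<lambda>i. \<xi> i \<omega>) k = (SUP n. state X0 n \<omega> k)"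
      by (rule LIMSEQ_unique[OF ibm_tendsto_limit LIMSEQ_SUP[OF incseq_ibm]])
    then show ?thesis by (simp add: ennreal_of_enat_Sup image_image load)
  qed
  have "(\<integral>\<^sup>+\<omega>. (SUP n. ennreal (load (state X0 n \<omega>) k)) \<partial>M) = (SUP n. mean_load X0 n k)"
    unfolding mean_load_def
  proof (rule nn_integral_monotone_convergence_SUP)
    show "incseq (\<lambda>n \<omega>. ennreal (load (state X0 n \<omega>) k))"
      using incseq_ibm[of X0 _ k] unfolding load[symmetric] by (auto simp: incseq_def le_fun_def)
  qed measurable
  also have "\<dots> \<le> ennreal C" by (intro SUP_least C)
  finally have "(\<integral>\<^sup>+\<omega>. (SUP n. ennreal (load (state X0 n \<omega>) k)) \<partial>M) \<noteq> \<infinity>"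
    by (auto simp: top_unique)
  then have "AE \<omega> in M. (SUP n. ennreal (load (state X0 n \<omega>) k)) \<noteq> \<infinity>"
    by (intro nn_integral_PInf_AE) measurable
  then show ?thesis
    unfolding lim[symmetric]
  proof eventually_elim
    case (elim \<omega>)
    then show ?case by (cases "ibm_limit X0 (\<lambda>i. \<xi> i \<omega>) k") simp_all
  qed
qed

end

section \<open>Almost sure finiteness\<close>

theorem theorem1p2:
  fixes M :: "'a measure" and \<mu> :: "nat pmf"
    and \<xi> :: "nat \<Rightarrow> 'a \<Rightarrow> nat" and X0 :: "int \<Rightarrow> enat"
  assumes "X0 \<in> configurations"
    and "(SUP k. X0 k) < \<infinity>"
    and "set_pmf \<mu> \<subseteq> {1..}"
    and "prob_space M"
    and "prob_space.indep_vars M (\<lambda>_. count_space UNIV) \<xi> {1..}"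
    and "\<And>n. n \<ge> 1 \<Longrightarrow> distr M (count_space UNIV) (\<xi> n) = measure_pmf \<mu>"
  shows "AE \<omega> in M. \<forall>k. ibm_limit X0 (\<lambda>n. \<xi> n \<omega>) k < \<infinity>"
proof -
  interpret iid_driven M \<mu> \<xi>
    using assms(3-6) by (intro iid_driven.intro iid_driven_axioms.intro)
  obtain K where K: "(SUP k. X0 k) = enat K" using assms(2) by (cases "SUP k. X0 k") auto
  have le: "X0 k \<le> enat K" for k unfolding K[symmetric] by (rule SUP_upper) simp
  have "X0 k \<noteq> \<infinity>" for k using le[of k] by (cases "X0 k") simp_all
  then have X0: "locally_finite X0"
    using assms(1) unfolding configurations_iff locally_finite_def by blast
  have "load X0 k \<le> K" for k using le[of k] load_eq[OF X0, of k] by (metis enat_ord_simps(1))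
  then show ?thesis using AE_ibm_limit_finite[OF X0, of K] by (subst AE_all_countable) blast
qed

end
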